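(* The irreducible representations $SB_3 \to \mathrm{GL}_2(\mathbb{C})$ are precisely the representations equivalent to a representation $\rho: SB_3 \to \mathrm{GL}_2(\mathbb{C})$ of the form $$\rho(\sigma_1)=\begin{pmatrix}\lambda_1&\lambda_1\\0&\lambda_2\end{pmatrix},\quad \rho(\sigma_2)=\begin{pmatrix}\lambda_2&0\\-\lambda_2&\lambda_1\end{pmatrix},\quad \rho(\tau_1)=\begin{pmatrix}a_1&b_1\\0&d_1\end{pmatrix},\quad \rho(\tau_2)=\begin{pmatrix}a_2&0\\c_2&d_2\end{pmatrix},$$ where $a_1,b_1,d_1,a_2,c_2,d_2,\lambda_1,\lambda_2\in\mathbb{C}$, with $a_1,d_1,a_2,d_2,\lambda_1,\lambda_2$ all nonzero, $\lambda_1^2+\lambda_2^2-\lambda_1\lambda_2\neq 0$, and $$d_1=a_2=a_1-\frac{b_1(\lambda_1-\lambda_2)}{\lambda_1},\qquad c_2=-\frac{b_1\lambda_2}{\lambda_1},\qquad d_2=a_1.$$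
   Context: The singular braid group $SB_3$ is the group generated by $\sigma_1,\sigma_2,\tau_1,\tau_2$ with defining relations $\sigma_1\sigma_2\sigma_1=\sigma_2\sigma_1\sigma_2$, $\tau_1\sigma_1=\sigma_1\tau_1$, $\tau_2\sigma_2=\sigma_2\tau_2$, $\sigma_1\sigma_2\tau_1=\tau_2\sigma_1\sigma_2$, $\sigma_2\sigma_1\tau_2=\tau_1\sigma_2\sigma_1$. Two representations $\rho,\rho': G\to\mathrm{GL}_m(\mathbb{C})$ are equivalent if there is $P\in\mathrm{GL}_m(\mathbb{C})$ with $\rho'(g)=P^{-1}\rho(g)P$ for all $g\in G$. A representation is irreducible if no subspace of $\mathbb{C}^m$ other than $0$ and $\mathbb{C}^m$ is invariant under the image of $G$. *)

theory Defs
  imports "HOL-Analysis.Analysis" "HOL-Algebra.Group"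
begin

text \<open>The letter \<open>(g, True)\<close> stands for the generator \<open>g\<close>, and \<open>(g, False)\<close> for its formal inverse.\<close>

type_synonym 'g word = "('g \<times> bool) list"

definition letter_inv :: "'g \<times> bool \<Rightarrow> 'g \<times> bool"
  where "letter_inv x = (fst x, \<not> snd x)"

inductive word_eq :: "('g word \<times> 'g word) set \<Rightarrow> 'g word \<Rightarrow> 'g word \<Rightarrow> bool"
  for R :: "('g word \<times> 'g word) set"
where
  rel: "(u, v) \<in> R \<Longrightarrow> word_eq R u v"
| cancel: "word_eq R [x, letter_inv x] []"
| refl: "word_eq R u u"
| sym: "word_eq R u v \<Longrightarrow> word_eq R v u"
| trans: "word_eq R u v \<Longrightarrow> word_eq R v w \<Longrightarrow> word_eq R u w"
| append: "word_eq R u u' \<Longrightarrow> word_eq R v v' \<Longrightarrow> word_eq R (u @ v) (u' @ v')"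

definition word_class :: "('g word \<times> 'g word) set \<Rightarrow> 'g word \<Rightarrow> 'g word set"
  where "word_class R u = {v. word_eq R u v}"

definition presented_group :: "('g word \<times> 'g word) set \<Rightarrow> 'g word set monoid"
  where "presented_group R =
    \<lparr>carrier = range (word_class R),
     mult = (\<lambda>A B. \<Union>u\<in>A. \<Union>v\<in>B. word_class R (u @ v)),
     one = word_class R []\<rparr>"

lemma word_class_eq_iff: "word_class R u = word_class R v \<longleftrightarrow> word_eq R u v"
proof
  assume "word_class R u = word_class R v"
  then have "v \<in> word_class R u"
    by (simp add: word_class_def word_eq.refl)
  then show "word_eq R u v"
    by (simp add: word_class_def)
next
  assume *: "word_eq R u v"
  have "word_eq R u w \<longleftrightarrow> word_eq R v w" for w
    using word_eq.trans[OF *, of w] word_eq.trans[OF word_eq.sym[OF *], of w] by iprover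
  then show "word_class R u = word_class R v"
    by (simp add: word_class_def)
qed

lemma presented_group_mult:
  "word_class R u \<otimes>\<^bsub>presented_group R\<^esub> word_class R v = word_class R (u @ v)"
proof -
  have eq: "word_class R (u' @ v') = word_class R (u @ v)"
    if "u' \<in> word_class R u" "v' \<in> word_class R v" for u' v'
  proof -
    have "word_eq R (u @ v) (u' @ v')"
      using that by (intro word_eq.append) (simp_all add: word_class_def)
    then show ?thesis
      by (simp add: word_class_eq_iff word_eq.sym)
  qed
  have "u \<in> word_class R u" "v \<in> word_class R v"
    by (simp_all add: word_class_def word_eq.refl)
  then have "(\<Union>u'\<in>word_class R u. \<Union>v'\<in>word_class R v. word_class R (u' @ v')) = word_class R (u @ v)"
    using eq by (metis (no_types, lifting) SUP_eq_const empty_iff)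
  then show ?thesis
    by (simp add: presented_group_def)
qed

lemma word_eq_inverse: "word_eq R (rev (map letter_inv u) @ u) []"
proof (induction u)
  case Nil
  show ?case by (simp add: word_eq.refl)
next
  case (Cons x u)
  have "word_eq R [letter_inv x, x] []"
    using word_eq.cancel[of R "letter_inv x"] by (simp add: letter_inv_def)
  then have "word_eq R (rev (map letter_inv u) @ [letter_inv x, x] @ u) (rev (map letter_inv u) @ [] @ u)"
    by (intro word_eq.append word_eq.refl)
  then have "word_eq R (rev (map letter_inv (x # u)) @ x # u) (rev (map letter_inv u) @ u)"
    by simp
  then show ?case
    using Cons.IH by (rule word_eq.trans)
qed

lemma group_presented_group: "group (presented_group R)"
proof (rule groupI)
  have carr: "carrier (presented_group R) = range (word_class R)"
    and one: "\<one>\<^bsub>presented_group R\<^esub> = word_class R []"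
    by (simp_all add: presented_group_def)
  show "x \<otimes>\<^bsub>presented_group R\<^esub> y \<in> carrier (presented_group R)"
    if "x \<in> carrier (presented_group R)" "y \<in> carrier (presented_group R)" for x y
    using that unfolding carr by (auto simp: presented_group_mult)
  show "\<one>\<^bsub>presented_group R\<^esub> \<in> carrier (presented_group R)"
    unfolding carr one by simp
  show "x \<otimes>\<^bsub>presented_group R\<^esub> y \<otimes>\<^bsub>presented_group R\<^esub> z
      = x \<otimes>\<^bsub>presented_group R\<^esub> (y \<otimes>\<^bsub>presented_group R\<^esub> z)"
    if "x \<in> carrier (presented_group R)" "y \<in> carrier (presented_group R)"
      "z \<in> carrier (presented_group R)" for x y z
    using that unfolding carr by (auto simp: presented_group_mult)
  show "\<one>\<^bsub>presented_group R\<^esub> \<otimes>\<^bsub>presented_group R\<^esub> x = x"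
    if "x \<in> carrier (presented_group R)" for x
    using that unfolding carr one by (auto simp: presented_group_mult)
  show "\<exists>y\<in>carrier (presented_group R). y \<otimes>\<^bsub>presented_group R\<^esub> x = \<one>\<^bsub>presented_group R\<^esub>"
    if x: "x \<in> carrier (presented_group R)" for x
  proof -
    obtain u where "x = word_class R u"
      using x unfolding carr by auto
    then have "word_class R (rev (map letter_inv u)) \<otimes>\<^bsub>presented_group R\<^esub> x = \<one>\<^bsub>presented_group R\<^esub>"
      unfolding one by (simp add: presented_group_mult word_class_eq_iff word_eq_inverse)
    then show ?thesis
      unfolding carr by blast
  qed
qed

datatype sb3_gen = Sigma1 | Sigma2 | Tau1 | Tau2

definition pos_word :: "'g list \<Rightarrow> 'g word"
  where "pos_word gs = map (\<lambda>g. (g, True)) gs"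

definition sb3_rels :: "(sb3_gen word \<times> sb3_gen word) set"
  where "sb3_rels =
    {(pos_word [Sigma1, Sigma2, Sigma1], pos_word [Sigma2, Sigma1, Sigma2]),
     (pos_word [Tau1, Sigma1], pos_word [Sigma1, Tau1]),
     (pos_word [Tau2, Sigma2], pos_word [Sigma2, Tau2]),
     (pos_word [Sigma1, Sigma2, Tau1], pos_word [Tau2, Sigma1, Sigma2]),
     (pos_word [Sigma2, Sigma1, Tau2], pos_word [Tau1, Sigma2, Sigma1])}"

definition SB3 :: "sb3_gen word set monoid"
  where "SB3 = presented_group sb3_rels"

definition sb3 :: "sb3_gen \<Rightarrow> sb3_gen word set"
  where "sb3 g = word_class sb3_rels (pos_word [g])"

definition GL :: "(complex ^ 'n ^ 'n) monoid"
  where "GL = \<lparr>carrier = {A. invertible A}, mult = (**), one = mat 1\<rparr>"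

lemma group_GL: "group (GL :: (complex ^ 'n ^ 'n) monoid)"
proof (rule groupI)
  show "A \<otimes>\<^bsub>GL\<^esub> B \<in> carrier GL" if "A \<in> carrier GL" "B \<in> carrier GL"
    for A B :: "complex ^ 'n ^ 'n"
    using that by (simp add: GL_def invertible_mult)
  show "\<one>\<^bsub>GL\<^esub> \<in> carrier (GL :: (complex ^ 'n ^ 'n) monoid)"
    by (simp add: GL_def invertible_def exI[of _ "mat 1"])
  show "A \<otimes>\<^bsub>GL\<^esub> B \<otimes>\<^bsub>GL\<^esub> C = A \<otimes>\<^bsub>GL\<^esub> (B \<otimes>\<^bsub>GL\<^esub> C)" for A B C :: "complex ^ 'n ^ 'n"
    by (simp add: GL_def matrix_mul_assoc)
  show "\<one>\<^bsub>GL\<^esub> \<otimes>\<^bsub>GL\<^esub> A = A" for A :: "complex ^ 'n ^ 'n"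
    by (simp add: GL_def)
  show "\<exists>B\<in>carrier GL. B \<otimes>\<^bsub>GL\<^esub> A = \<one>\<^bsub>GL\<^esub>" if "A \<in> carrier GL" for A :: "complex ^ 'n ^ 'n"
  proof -
    have "invertible A"
      using that by (simp add: GL_def)
    then obtain B where B: "A ** B = mat 1" "B ** A = mat 1"
      unfolding invertible_def by blast
    then have "invertible B"
      unfolding invertible_def by blast
    with B show ?thesis
      by (intro bexI[of _ B]) (simp_all add: GL_def)
  qed
qed

definition matrix_rep :: "'g monoid \<Rightarrow> ('g \<Rightarrow> complex ^ 'n ^ 'n) \<Rightarrow> bool"
  where "matrix_rep G \<rho> \<longleftrightarrow> \<rho> \<in> hom G GL"

definition equivalent_rep ::
    "'g monoid \<Rightarrow> ('g \<Rightarrow> complex ^ 'n ^ 'n) \<Rightarrow> ('g \<Rightarrow> complex ^ 'n ^ 'n) \<Rightarrow> bool"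
  where "equivalent_rep G \<rho> \<rho>' \<longleftrightarrow>
    (\<exists>P. invertible P \<and> (\<forall>g\<in>carrier G. \<rho>' g = matrix_inv P ** \<rho> g ** P))"

text \<open>The constant \<open>vec.subspace\<close> refers to scalars in the base field, so these are complex subspaces;
  the unqualified \<open>subspace\<close> would mean real subspaces.\<close>

definition irreducible_rep :: "'g monoid \<Rightarrow> ('g \<Rightarrow> complex ^ 'n ^ 'n) \<Rightarrow> bool"
  where "irreducible_rep G \<rho> \<longleftrightarrow>
    (\<forall>W. vec.subspace W \<and> (\<forall>g\<in>carrier G. \<forall>w\<in>W. \<rho> g *v w \<in> W) \<longrightarrow> W = {0} \<or> W = UNIV)"

end

theory Submission
  imports Defs
begin

text \<open>A representation of degree 2 is irreducible iff its generators have no common eigenvector.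
  For an irreducible representation of \<open>SB3\<close>, already \<open>\<sigma>\<^sub>1\<close> and \<open>\<sigma>\<^sub>2\<close> have no common
  eigenvector: if they are not scalar, each \<open>\<tau>\<^sub>i\<close> shares the eigenvectors of \<open>\<sigma>\<^sub>i\<close> because it
  commutes with it, and if they are scalar, then \<open>\<sigma>\<^sub>1 = \<sigma>\<^sub>2\<close> and \<open>\<tau>\<^sub>1 = \<tau>\<^sub>2\<close>.
  Hence an eigenvector \<open>v\<close> of \<open>\<sigma>\<^sub>1\<close> together with \<open>v - l\<^sub>2\<^sup>-\<^sup>1 \<sigma>\<^sub>2 v\<close>, where \<open>l\<^sub>2\<close> is the other
  eigenvalue, is a basis, and in this basis the relations force the claimed form.
  Conversely, a common eigenvector of the two matrices for \<open>\<sigma>\<^sub>1\<close> and \<open>\<sigma>\<^sub>2\<close> exists only if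
  \<open>l\<^sub>1\<^sup>2 + l\<^sub>2\<^sup>2 - l\<^sub>1 l\<^sub>2 = 0\<close>.\<close>

section \<open>Linear algebra in dimension two\<close>

lemma vec2_eq_iff: "v = w \<longleftrightarrow> v$1 = w$1 \<and> v$2 = w$2" for v w :: "'a ^ 2"
  by (simp add: vec_eq_iff forall_2)

lemma mat2_eq_iff: "A = B \<longleftrightarrow> A$1$1 = B$1$1 \<and> A$1$2 = B$1$2 \<and> A$2$1 = B$2$1 \<and> A$2$2 = B$2$2"
  for A B :: "'a ^ 2 ^ 2"
  by (auto simp: vec_eq_iff forall_2)

lemma matrix_vector_mult_2:
  "(A *v v)$i = A$i$1 * v$1 + A$i$2 * v$2" for A :: "'a::semiring_1 ^ 2 ^ 'm"
  by (simp add: matrix_vector_mult_def sum_2)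

lemma matrix_matrix_mult_2:
  "(A ** B)$i$j = A$i$1 * B$1$j + A$i$2 * B$2$j" for A :: "'a::semiring_1 ^ 2 ^ 'm"
  by (simp add: matrix_matrix_mult_def sum_2)

lemma mat_vector_mult: "mat c *v v = c *s v" for v :: "'a::semiring_1 ^ 'n"
proof -
  have "(\<Sum>j\<in>UNIV. (if i = j then c else 0) * v$j) = (\<Sum>j\<in>UNIV. if i = j then c * v$j else 0)" for i
    by (rule sum.cong) simp_all
  then show ?thesis
    by (simp add: vec_eq_iff matrix_vector_mult_def mat_def)
qed

text \<open>The determinant of the matrix with columns \<open>v\<close> and \<open>w\<close>; its
  vanishing is a division-free test for linear dependence.\<close>

definition wedge :: "'a::field ^ 2 \<Rightarrow> 'a ^ 2 \<Rightarrow> 'a"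
  where "wedge v w = v$1 * w$2 - v$2 * w$1"

lemma wedge_eq_0_imp_multiple:
  assumes "v \<noteq> 0" "wedge v w = 0"
  obtains c where "w = c *s v"
proof (cases "v$1 = 0")
  case True
  then have "w = (w$2 / v$2) *s v"
    using assms by (auto simp: vec2_eq_iff wedge_def)
  then show ?thesis by (rule that)
next
  case False
  then have "w = (w$1 / v$1) *s v"
    using assms by (simp add: vec2_eq_iff wedge_def field_simps)
  then show ?thesis by (rule that)
qed

lemma wedge_neq_0_imp_basis:
  assumes "wedge v w \<noteq> 0"
  obtains a b where "x = a *s v + b *s w"
proof -
  \<comment> \<open>This is Cramer's rule with the denominator cleared.\<close>
  have "wedge v w *s x = wedge x w *s v + wedge v x *s w"
    by (simp add: vec2_eq_iff wedge_def algebra_simps)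
  then have "x = inverse (wedge v w) *s (wedge x w *s v + wedge v x *s w)"
    using assms by (metis left_inverse vector_smult_assoc vector_smult_lid)
  then have "x = (wedge x w / wedge v w) *s v + (wedge v x / wedge v w) *s w"
    by (simp add: vec.scale_right_distrib divide_inverse mult.commute)
  then show ?thesis by (rule that)
qed

text \<open>If \<open>T *v v\<close> were not a multiple of \<open>v\<close>, the two would form a
  basis. Commutation makes \<open>T *v v\<close> another eigenvector of \<open>S\<close> for
  \<open>c\<close>, so \<open>S\<close> would be the scalar matrix \<open>mat c\<close>.\<close>

lemma commuting_eigenvector:
  fixes S T :: "'a::field ^ 2 ^ 2"
  assumes "S ** T = T ** S" "v \<noteq> 0" "S *v v = c *s v" "S \<noteq> mat c"
  shows "\<exists>d. T *v v = d *s v"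
proof (cases "wedge v (T *v v) = 0")
  case True
  then show ?thesis
    using wedge_eq_0_imp_multiple assms(2) by metis
next
  case False
  have STv: "S *v (T *v v) = c *s (T *v v)"
    by (metis assms(1,3) matrix_vector_mul_assoc vector_scalar_commute)
  have "S *v x = mat c *v x" for x
  proof -
    obtain a b where x: "x = a *s v + b *s (T *v v)"
      using wedge_neq_0_imp_basis[OF False] .
    show ?thesis
      unfolding x mat_vector_mult
      by (simp add: matrix_vector_right_distrib vector_scalar_commute STv assms(3)
          vec.scale_right_distrib vector_smult_assoc mult.commute)
  qed
  then show ?thesis
    using assms(4) matrix_eq by blast
qed

lemma eigenvector_exists_2:
  fixes A :: "complex ^ 2 ^ 2"
  obtains c v where "v \<noteq> 0" "A *v v = c *s v"
proof (cases "A$1$2 = 0")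
  case True
  show ?thesis
    by (rule that[of "vector [0, 1]" "A$2$2"])
      (simp_all add: True vec2_eq_iff matrix_vector_mult_2)
next
  case False
  \<comment> \<open>The radicand is the discriminant of the characteristic polynomial, so
    \<open>c\<close> is one of its roots.\<close>
  define s where "s = csqrt ((A$1$1 - A$2$2)\<^sup>2 + 4 * A$1$2 * A$2$1)"
  define c where "c = (A$1$1 + A$2$2 + s) / 2"
  have "s\<^sup>2 = (A$1$1 - A$2$2)\<^sup>2 + 4 * A$1$2 * A$2$1"
    by (simp add: s_def)
  \<comment> \<open>The characteristic equation for \<open>c\<close>, written as the second
    coordinate of the eigenvector equation for (\<open>A$1$2\<close>, \<open>c - A$1$1\<close>); the
    first coordinate holds identically.\<close>
  then have "A$2$1 * A$1$2 + A$2$2 * (c - A$1$1) = c * (c - A$1$1)"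
    unfolding c_def by (simp add: field_simps power2_eq_square) algebra
  then show ?thesis
    using False
    by (intro that[of "vector [A$1$2, c - A$1$1]" c])
      (simp_all add: vec2_eq_iff matrix_vector_mult_2 algebra_simps)
qed

lemma matrix_inv_inverse:
  assumes "invertible A"
  shows "A ** matrix_inv A = mat 1" "matrix_inv A ** A = mat 1"
  using assms someI_ex[of "\<lambda>B. A ** B = mat 1 \<and> B ** A = mat 1"]
  unfolding invertible_def matrix_inv_def by auto

lemma matrix_mult_cancel_left:
  assumes "invertible A"
  shows "A ** B = A ** C \<longleftrightarrow> B = C"
  by (metis assms matrix_inv_inverse(2) matrix_mul_assoc matrix_mul_lid)

lemma matrix_mult_cancel_right:
  assumes "invertible A"
  shows "B ** A = C ** A \<longleftrightarrow> B = C"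
  by (metis assms matrix_inv_inverse(1) matrix_mul_assoc matrix_mul_rid)

section \<open>Representations of presented groups\<close>

text \<open>The eigenvalue may depend on \<open>g\<close>. The set \<open>X\<close> is a parameter
  so that the notion applies both to a whole group and to a set of generators.\<close>

definition common_eigenvector :: "('g \<Rightarrow> 'a::field ^ 'n ^ 'n) \<Rightarrow> 'g set \<Rightarrow> 'a ^ 'n \<Rightarrow> bool"
  where "common_eigenvector \<rho> X v \<longleftrightarrow> v \<noteq> 0 \<and> (\<forall>g\<in>X. \<exists>c. \<rho> g *v v = c *s v)"

text \<open>In dimension two a proper nonzero invariant subspace is a line, and a line is invariant
  exactly when it is spanned by a common eigenvector.\<close>

lemma irreducible_rep_iff_no_common_eigenvector:
  fixes \<rho> :: "'g \<Rightarrow> complex ^ 2 ^ 2"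
  shows "irreducible_rep G \<rho> \<longleftrightarrow> (\<nexists>v. common_eigenvector \<rho> (carrier G) v)"
proof
  assume irr: "irreducible_rep G \<rho>"
  show "\<nexists>v. common_eigenvector \<rho> (carrier G) v"
  proof
    assume "\<exists>v. common_eigenvector \<rho> (carrier G) v"
    then obtain v where v: "v \<noteq> 0" and eig: "\<And>g. g \<in> carrier G \<Longrightarrow> \<exists>c. \<rho> g *v v = c *s v"
      unfolding common_eigenvector_def by blast
    define W where "W = range (\<lambda>c. c *s v)"
    have "vec.subspace W"
      unfolding W_def vec.span_singleton[symmetric] by (rule vec.subspace_span)
    moreover have "\<rho> g *v w \<in> W" if g: "g \<in> carrier G" and w: "w \<in> W" for g w
    proof -
      obtain a c where "w = a *s v" "\<rho> g *v v = c *s v"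
        using eig[OF g] w unfolding W_def by blast
      then have "\<rho> g *v w = (a * c) *s v"
        by (simp add: vector_scalar_commute vector_smult_assoc)
      then show ?thesis
        unfolding W_def by blast
    qed
    ultimately have "W = {0} \<or> W = UNIV"
      using irr unfolding irreducible_rep_def by blast
    moreover have "v \<in> W"
      unfolding W_def by (rule range_eqI[of _ _ 1]) simp
    ultimately have "W = UNIV"
      using v by blast
    moreover have "wedge v w = 0" if "w \<in> W" for w
      using that unfolding W_def by (auto simp: wedge_def)
    \<comment> \<open>If the line were the whole plane, \<open>v\<close> would be parallel to both
      standard basis vectors, hence zero.\<close>
    ultimately have "wedge v (vector [0, 1]) = 0" "wedge v (vector [1, 0]) = 0"
      by blast+
    then show False
      using v by (simp add: wedge_def vec2_eq_iff)
  qed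
next
  assume none: "\<nexists>v. common_eigenvector \<rho> (carrier G) v"
  show "irreducible_rep G \<rho>"
    unfolding irreducible_rep_def
  proof (intro allI impI, elim conjE)
    fix W
    assume W: "vec.subspace W" and inv: "\<forall>g\<in>carrier G. \<forall>w\<in>W. \<rho> g *v w \<in> W"
    show "W = {0} \<or> W = UNIV"
    proof (cases "W = {0}")
      case False
      then obtain w where w: "w \<in> W" "w \<noteq> 0"
        using vec.subspace_0[OF W] by blast
      then obtain g where g: "g \<in> carrier G" "\<nexists>c. \<rho> g *v w = c *s w"
        using none unfolding common_eigenvector_def by blast
      then have indep: "wedge w (\<rho> g *v w) \<noteq> 0"
        using w(2) wedge_eq_0_imp_multiple by metis
      have "x \<in> W" for x
      proof -
        obtain a b where x: "x = a *s w + b *s (\<rho> g *v w)"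
          using wedge_neq_0_imp_basis[OF indep] .
        show ?thesis
          unfolding x using W inv g(1) w(1)
          by (intro vec.subspace_add vec.subspace_scale) auto
      qed
      then show ?thesis by blast
    qed simp
  qed
qed

lemma matrix_rep_invertible: "matrix_rep G \<rho> \<Longrightarrow> g \<in> carrier G \<Longrightarrow> invertible (\<rho> g)"
  by (auto simp: matrix_rep_def hom_def GL_def)

lemma word_class_in_carrier [simp]: "word_class R u \<in> carrier (presented_group R)"
  by (simp add: presented_group_def)

context
  fixes R :: "('g word \<times> 'g word) set" and \<rho> :: "'g word set \<Rightarrow> complex ^ 'n ^ 'n"
  assumes rep: "matrix_rep (presented_group R) \<rho>"
begin

lemma rep_append: "\<rho> (word_class R (u @ v)) = \<rho> (word_class R u) ** \<rho> (word_class R v)"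
  using hom_mult[of \<rho> "presented_group R" GL "word_class R u" "word_class R v"] rep
  by (simp add: matrix_rep_def presented_group_mult GL_def)

lemma rep_Nil: "\<rho> (word_class R []) = mat 1"
proof -
  have "\<rho> \<one>\<^bsub>presented_group R\<^esub> = \<one>\<^bsub>GL\<^esub>"
    using hom_one rep group_presented_group group_GL unfolding matrix_rep_def by blast
  then show ?thesis
    by (simp add: presented_group_def GL_def)
qed

lemma rep_pos_word_Cons:
  "\<rho> (word_class R (pos_word (g # gs))) =
    \<rho> (word_class R (pos_word [g])) ** \<rho> (word_class R (pos_word gs))"
  using rep_append[of "[(g, True)]" "pos_word gs"] by (simp add: pos_word_def)

text \<open>A formal inverse scales \<open>v\<close> by the inverse scalar, and scalars multiply
  along a word, so induction on words reaches every group element.\<close>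

lemma common_eigenvector_generators:
  assumes "common_eigenvector \<rho> (range (\<lambda>g. word_class R (pos_word [g]))) v"
  shows "common_eigenvector \<rho> (carrier (presented_group R)) v"
proof -
  have v: "v \<noteq> 0" and gen: "\<exists>c. \<rho> (word_class R [(g, True)]) *v v = c *s v" for g
    using assms by (auto simp: common_eigenvector_def pos_word_def)
  have letter: "\<exists>c. \<rho> (word_class R [x]) *v v = c *s v" for x
  proof (cases x)
    case (Pair g b)
    obtain c where c: "\<rho> (word_class R [(g, True)]) *v v = c *s v"
      using gen by blast
    have "word_class R [(g, False), (g, True)] = word_class R []"
      using word_eq.cancel[of R "(g, False)"] by (simp add: word_class_eq_iff letter_inv_def)
    then have "\<rho> (word_class R [(g, False)]) ** \<rho> (word_class R [(g, True)]) = mat 1"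
      using rep_append[of "[(g, False)]" "[(g, True)]"] rep_Nil by simp
    then have vc: "v = c *s (\<rho> (word_class R [(g, False)]) *v v)"
      by (metis c matrix_vector_mul_assoc matrix_vector_mul_lid vector_scalar_commute)
    then have "c \<noteq> 0"
      using v by auto
    then have "\<rho> (word_class R [(g, False)]) *v v = inverse c *s v"
      by (metis vc left_inverse vector_smult_assoc vector_smult_lid)
    with c show ?thesis
      unfolding Pair by (cases b) (simp_all only:, blast+)
  qed
  have "\<exists>c. \<rho> (word_class R u) *v v = c *s v" for u
  proof (induction u)
    case Nil
    show ?case
      by (rule exI[of _ 1]) (simp add: rep_Nil)
  next
    case (Cons x u)
    then obtain c where c: "\<rho> (word_class R u) *v v = c *s v" by blast
    obtain d where d: "\<rho> (word_class R [x]) *v v = d *s v"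
      using letter by blast
    have "\<rho> (word_class R (x # u)) *v v = (c * d) *s v"
      using rep_append[of "[x]" u] c d
      by (simp add: matrix_vector_mul_assoc[symmetric] vector_scalar_commute vector_smult_assoc)
    then show ?case by blast
  qed
  then show ?thesis
    using v by (auto simp: common_eigenvector_def presented_group_def)
qed

end

section \<open>Conjugation and intertwining of representations\<close>

lemma matrix_rep_conjugate:
  assumes "matrix_rep G \<rho>" "invertible P"
  shows "matrix_rep G (\<lambda>g. matrix_inv P ** \<rho> g ** P)"
proof -
  have Pi: "invertible (matrix_inv P)"
    using matrix_inv_inverse[OF assms(2)] unfolding invertible_def by blast
  have "matrix_inv P ** (\<rho> g ** \<rho> h) ** P = (matrix_inv P ** \<rho> g ** P) ** (matrix_inv P ** \<rho> h ** P)"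
    for g h
    by (metis assms(2) matrix_inv_inverse(1) matrix_mul_assoc matrix_mul_rid)
  then show ?thesis
    using assms Pi by (auto simp: matrix_rep_def hom_def GL_def intro!: invertible_mult)
qed

text \<open>Equivalence is needed from the conjugated representation back to the original one, so
  the witness is \<open>matrix_inv P\<close>.\<close>

lemma equivalent_rep_conjugate:
  assumes "invertible P"
  shows "equivalent_rep G (\<lambda>g. matrix_inv P ** \<rho> g ** P) \<rho>"
  unfolding equivalent_rep_def
proof (intro exI[of _ "matrix_inv P"] conjI ballI)
  note P = matrix_inv_inverse[OF assms]
  show inv: "invertible (matrix_inv P)"
    using P unfolding invertible_def by blast
  have "matrix_inv (matrix_inv P) = P"
    using P matrix_inv_inverse(2)[OF inv] by (metis matrix_mul_assoc matrix_mul_lid matrix_mul_rid)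
  then show "\<rho> g = matrix_inv (matrix_inv P) ** (matrix_inv P ** \<rho> g ** P) ** matrix_inv P" for g
    using P by (metis matrix_mul_assoc matrix_mul_lid matrix_mul_rid)
qed

text \<open>The intertwiner \<open>P\<close> carries eigenvectors to eigenvectors with the same
  eigenvalues, and injectivity keeps them nonzero.\<close>

lemma common_eigenvector_intertwine:
  assumes "common_eigenvector \<rho> X v" "invertible P" "\<And>g. g \<in> X \<Longrightarrow> P ** \<rho> g = \<rho>' g ** P"
  shows "common_eigenvector \<rho>' X (P *v v)"
proof -
  have "P *v v \<noteq> 0"
    using assms(1,2) matrix_inv_inverse(2)[of P]
    by (metis common_eigenvector_def matrix_vector_mul_assoc matrix_vector_mul_lid matrix_vector_mult_0_right)
  then show ?thesis
    using assms(1,3) unfolding common_eigenvector_def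
    by (metis matrix_vector_mul_assoc vector_scalar_commute)
qed

section \<open>The singular braid group\<close>

lemma sb3_in_carrier [simp]: "sb3 g \<in> carrier SB3"
  by (simp add: sb3_def SB3_def)

text \<open>Related words have the same class, hence the same image, and a positive word is sent to
  the product of the images of its letters.\<close>

lemma SB3_relations:
  assumes "matrix_rep SB3 \<rho>"
  shows "\<rho> (sb3 Sigma1) ** \<rho> (sb3 Sigma2) ** \<rho> (sb3 Sigma1) = \<rho> (sb3 Sigma2) ** \<rho> (sb3 Sigma1) ** \<rho> (sb3 Sigma2)"
    and "\<rho> (sb3 Tau1) ** \<rho> (sb3 Sigma1) = \<rho> (sb3 Sigma1) ** \<rho> (sb3 Tau1)"
    and "\<rho> (sb3 Tau2) ** \<rho> (sb3 Sigma2) = \<rho> (sb3 Sigma2) ** \<rho> (sb3 Tau2)"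
    and "\<rho> (sb3 Sigma1) ** \<rho> (sb3 Sigma2) ** \<rho> (sb3 Tau1) = \<rho> (sb3 Tau2) ** \<rho> (sb3 Sigma1) ** \<rho> (sb3 Sigma2)"
proof -
  have rep: "matrix_rep (presented_group sb3_rels) \<rho>"
    using assms by (simp add: SB3_def)
  have rel: "\<rho> (word_class sb3_rels u) = \<rho> (word_class sb3_rels v)" if "(u, v) \<in> sb3_rels" for u v
    using word_eq.rel[OF that] by (simp add: word_class_eq_iff[symmetric])
  have two: "\<rho> (word_class sb3_rels (pos_word [g, h])) = \<rho> (sb3 g) ** \<rho> (sb3 h)" for g h
    unfolding sb3_def by (rule rep_pos_word_Cons[OF rep])
  have three: "\<rho> (word_class sb3_rels (pos_word [g, h, k])) = \<rho> (sb3 g) ** \<rho> (sb3 h) ** \<rho> (sb3 k)" for g h k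
    using rep_pos_word_Cons[OF rep, of g "[h, k]"] two[of h k]
    by (simp add: sb3_def matrix_mul_assoc)
  show "\<rho> (sb3 Sigma1) ** \<rho> (sb3 Sigma2) ** \<rho> (sb3 Sigma1) = \<rho> (sb3 Sigma2) ** \<rho> (sb3 Sigma1) ** \<rho> (sb3 Sigma2)"
    "\<rho> (sb3 Sigma1) ** \<rho> (sb3 Sigma2) ** \<rho> (sb3 Tau1) = \<rho> (sb3 Tau2) ** \<rho> (sb3 Sigma1) ** \<rho> (sb3 Sigma2)"
    unfolding three[symmetric] by (rule rel, simp add: sb3_rels_def)+
  show "\<rho> (sb3 Tau1) ** \<rho> (sb3 Sigma1) = \<rho> (sb3 Sigma1) ** \<rho> (sb3 Tau1)"
    "\<rho> (sb3 Tau2) ** \<rho> (sb3 Sigma2) = \<rho> (sb3 Sigma2) ** \<rho> (sb3 Tau2)"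
    unfolding two[symmetric] by (rule rel, simp add: sb3_rels_def)+
qed

lemma SB3_irreducible_no_common_eigenvector:
  fixes \<rho> :: "sb3_gen word set \<Rightarrow> complex ^ 2 ^ 2"
  assumes rep: "matrix_rep SB3 \<rho>" and irr: "irreducible_rep SB3 \<rho>"
  shows "\<not> common_eigenvector \<rho> {sb3 Sigma1, sb3 Sigma2} v"
proof
  let ?S1 = "\<rho> (sb3 Sigma1)" and ?S2 = "\<rho> (sb3 Sigma2)"
  let ?T1 = "\<rho> (sb3 Tau1)" and ?T2 = "\<rho> (sb3 Tau2)"
  note relations = SB3_relations[OF rep]
  have inv: "invertible (\<rho> (sb3 g))" for g
    using matrix_rep_invertible[OF rep] by simp
  have no_common: False
    if "w \<noteq> 0" "\<exists>c. ?S1 *v w = c *s w" "\<exists>c. ?S2 *v w = c *s w"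
      "\<exists>c. ?T1 *v w = c *s w" "\<exists>c. ?T2 *v w = c *s w" for w
  proof -
    have "\<exists>c. \<rho> (sb3 g) *v w = c *s w" for g
      using that by (cases g) auto
    then have "common_eigenvector \<rho> (range sb3) w"
      using \<open>w \<noteq> 0\<close> by (simp add: common_eigenvector_def)
    then have "common_eigenvector \<rho> (carrier SB3) w"
      using common_eigenvector_generators[of sb3_rels \<rho> w] rep
      by (simp add: SB3_def sb3_def[abs_def])
    then show False
      using irr irreducible_rep_iff_no_common_eigenvector by blast
  qed
  have mat_comm: "mat c ** A = A ** mat c" for c :: complex and A :: "complex ^ 2 ^ 2"
    by (simp add: mat2_eq_iff matrix_matrix_mult_2 mat_def)
  \<comment> \<open>Commuting with a scalar matrix says nothing about eigenvectors, so this case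
    must be excluded first. A scalar matrix is central, and the braid relation then cancels to
    \<open>?S1 = ?S2\<close>.\<close>
  have not_scalar: "?S1 \<noteq> mat c \<and> ?S2 \<noteq> mat c" for c
  proof (rule ccontr)
    assume scalar: "\<not> ?thesis"
    have S: "?S1 = ?S2"
    proof (cases "?S1 = mat c")
      case True
      then have "(?S2 ** ?S1) ** ?S1 = (?S2 ** ?S1) ** ?S2"
        using relations(1) by (metis mat_comm)
      then show ?thesis
        using inv matrix_mult_cancel_left by (metis invertible_mult)
    next
      case False
      then have "?S1 ** (?S1 ** ?S2) = ?S2 ** (?S1 ** ?S2)"
        using relations(1) scalar by (metis mat_comm matrix_mul_assoc)
      then show ?thesis
        using inv matrix_mult_cancel_right by (metis invertible_mult)
    qed
    have S1: "?S1 = mat c" and S2: "?S2 = mat c"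
      using scalar S by auto
    \<comment> \<open>The product of the two scalar matrices moves past \<open>?T1\<close>. After
      cancelling it, any eigenvector of \<open>?T1\<close> is common to all four generators.\<close>
    have "?T1 ** (?S1 ** ?S2) = ?T2 ** (?S1 ** ?S2)"
      using relations(4) unfolding S1 S2 by (metis mat_comm matrix_mul_assoc)
    then have T: "?T1 = ?T2"
      using inv matrix_mult_cancel_right by (metis invertible_mult)
    obtain w d where w: "w \<noteq> 0" "?T1 *v w = d *s w"
      by (rule eigenvector_exists_2)
    have "?S1 *v w = c *s w"
      unfolding S1 by (rule mat_vector_mult)
    with w S T show False
      using no_common[of w] by metis
  qed
  assume "common_eigenvector \<rho> {sb3 Sigma1, sb3 Sigma2} v"
  then obtain c1 c2 where v: "v \<noteq> 0" "?S1 *v v = c1 *s v" "?S2 *v v = c2 *s v"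
    unfolding common_eigenvector_def by auto
  have "\<exists>d. ?T1 *v v = d *s v"
    using commuting_eigenvector[OF _ v(1,2)] relations(2) not_scalar by metis
  moreover have "\<exists>d. ?T2 *v v = d *s v"
    using commuting_eigenvector[OF _ v(1,3)] relations(3) not_scalar by metis
  ultimately show False
    using no_common v by blast
qed

section \<open>Normal forms of the generators\<close>

text \<open>The hypotheses fix both first columns and the determinant of \<open>S1\<close>. The
  second columns follow from the determinants and two entries of the braid relation.\<close>

lemma normal_form_braid:
  fixes S1 S2 :: "'a::field ^ 2 ^ 2"
  assumes rel: "S1 ** S2 ** S1 = S2 ** S1 ** S2"
    and S1: "S1$1$1 = l1" "S1$2$1 = 0" and S2: "S2$1$1 = l2" "S2$2$1 = - l2"
    and l2: "det S1 = l1 * l2" and inv: "det S1 \<noteq> 0" "det S2 \<noteq> 0"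
  shows "S1 = vector [vector [l1, l1], vector [0, l2]]"
    and "S2 = vector [vector [l2, 0], vector [- l2, l1]]"
proof -
  have nz: "l1 \<noteq> 0" "l2 \<noteq> 0"
    using inv l2 by auto
  have S122: "S1$2$2 = l2"
    using l2 S1 nz by (simp add: det_2)
  \<comment> \<open>Taking determinants in the braid relation forces
    \<open>det S1 = det S2\<close>.\<close>
  have "det S1 * det S2 * det S1 = det S2 * det S1 * det S2"
    using rel by (metis det_mul)
  then have "det S2 = l1 * l2"
    using inv l2 by simp
  then have q: "S2$1$2 = l1 - S2$2$2"
    using S2 nz by (simp add: det_2) algebra
  \<comment> \<open>The (2,1) entry of the braid relation; the (1,1) entry is used further
    below.\<close>
  have "S1$2$2 * S2$2$1 * S1$1$1 = (S2$2$1 * S1$1$1) * S2$1$1 + (S2$2$1 * S1$1$2 + S2$2$2 * S1$2$2) * S2$2$1"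
    using rel S1 by (simp add: mat2_eq_iff matrix_matrix_mult_2)
  then have "l2 * l2 * S1$1$2 = l2 * l2 * S2$2$2"
    unfolding S1 S2 S122 by algebra
  then have p: "S1$1$2 = S2$2$2"
    using nz by simp
  have "(S1$1$1 * S2$1$1 + S1$1$2 * S2$2$1) * S1$1$1
      = (S2$1$1 * S1$1$1) * S2$1$1 + (S2$1$1 * S1$1$2 + S2$1$2 * S1$2$2) * S2$2$1"
    using rel S1 by (simp add: mat2_eq_iff matrix_matrix_mult_2)
  then have "l2 * l1 * S2$2$2 = l2 * l1 * l1"
    unfolding S1 S2 S122 p q by algebra
  then have r: "S2$2$2 = l1"
    using nz by simp
  show "S1 = vector [vector [l1, l1], vector [0, l2]]"
    and "S2 = vector [vector [l2, 0], vector [- l2, l1]]"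
    using S1 S2 S122 p q r by (simp_all add: mat2_eq_iff)
qed

text \<open>Commutation makes \<open>T1\<close> upper and \<open>T2\<close> lower triangular and
  determines the diagonal of \<open>T1\<close>. The product \<open>S1 ** S2\<close> has zero (1,1)
  entry, so \<open>rel\<close> matches the two diagonals in swapped order.\<close>

lemma normal_form_singular:
  fixes T1 T2 :: "'a::field ^ 2 ^ 2"
  assumes S1: "S1 = vector [vector [l1, l1], vector [0, l2]]"
    and S2: "S2 = vector [vector [l2, 0], vector [- l2, l1]]"
    and nz: "l1 \<noteq> 0" "l2 \<noteq> 0"
    and T1: "T1 ** S1 = S1 ** T1" and T2: "T2 ** S2 = S2 ** T2"
    and rel: "S1 ** S2 ** T1 = T2 ** S1 ** S2"
  obtains a b d where "T1 = vector [vector [a, b], vector [0, d]]"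
    "T2 = vector [vector [d, 0], vector [- (b * l2 / l1), a]]" "d = a - b * (l1 - l2) / l1"
proof -
  note entries = mat2_eq_iff matrix_matrix_mult_2 S1 S2
  have c: "T1$2$1 = 0"
    using T1 nz by (auto simp: entries)
  have d: "T1$2$2 = T1$1$1 - T1$1$2 * (l1 - l2) / l1"
    using T1 nz by (simp add: entries field_simps)
  have b2: "T2$1$2 = 0"
    using T2 nz by (auto simp: entries)
  have "l1 * l1 * T1$2$2 = l1 * l1 * T2$1$1"
    using rel by (simp add: entries c b2 algebra_simps)
  then have a2: "T2$1$1 = T1$2$2"
    using nz by simp
  have "l2 * l2 * T1$1$1 = l2 * l2 * T2$2$2"
    using rel by (simp add: entries c b2 algebra_simps)
  then have d2: "T2$2$2 = T1$1$1"
    using nz by simp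
  \<comment> \<open>The (2,2) entry of \<open>rel\<close>. The formula for \<open>d\<close> then
    turns the right-hand side into a multiple of \<open>T1$1$2\<close>.\<close>
  have "l1 * l1 * T2$2$1 = - l2 * l2 * T1$1$2 + l1 * l2 * (T1$2$2 - T1$1$1)"
    using rel by (simp add: entries c b2 d2 algebra_simps)
  moreover have "l1 * (T1$2$2 - T1$1$1) = - T1$1$2 * (l1 - l2)"
    using d nz by (simp add: field_simps)
  ultimately have "l1 * (l1 * T2$2$1) = l1 * (- T1$1$2 * l2)"
    by algebra
  then have "l1 * T2$2$1 = - T1$1$2 * l2"
    using nz by (simp only: mult_cancel_left) simp
  then have c2: "T2$2$1 = - (T1$1$2 * l2 / l1)"
    using nz by (simp add: field_simps)
  show ?thesis
    by (rule that[of "T1$1$1" "T1$1$2" "T1$2$2"])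
      (use c d b2 a2 d2 c2 in \<open>simp_all add: mat2_eq_iff\<close>)
qed

text \<open>Both coordinates of a common eigenvector are nonzero, so both eigenvalues equal
  \<open>l2\<close>. The two eigenvector equations for \<open>l2\<close> are compatible exactly when
  the quadratic form vanishes.\<close>

lemma normal_form_common_eigenvector:
  fixes \<rho> :: "'g \<Rightarrow> 'a::field ^ 2 ^ 2"
  assumes "l1 \<noteq> 0" "l2 \<noteq> 0"
    and \<rho>: "\<rho> x = vector [vector [l1, l1], vector [0, l2]]"
    "\<rho> y = vector [vector [l2, 0], vector [- l2, l1]]"
  shows "(\<exists>v. common_eigenvector \<rho> {x, y} v) \<longleftrightarrow> l1\<^sup>2 + l2\<^sup>2 - l1 * l2 = 0"
proof
  assume "\<exists>v. common_eigenvector \<rho> {x, y} v"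
  then obtain v c d where v: "v \<noteq> 0" "\<rho> x *v v = c *s v" "\<rho> y *v v = d *s v"
    unfolding common_eigenvector_def by auto
  then have 1: "l1 * v$1 + l1 * v$2 = c * v$1" "l2 * v$2 = c * v$2"
    and 2: "l2 * v$1 = d * v$1" "- l2 * v$1 + l1 * v$2 = d * v$2"
    by (simp_all add: \<rho> vec2_eq_iff matrix_vector_mult_2)
  have v1: "v$1 \<noteq> 0"
    using 1(1) v(1) assms(1) by (auto simp: vec2_eq_iff)
  then have "v$2 \<noteq> 0"
    using 2 assms(2) by auto
  then have "c = l2" "d = l2"
    using 1(2) 2(1) v1 by auto
  with 1(1) 2(2) have "(l1\<^sup>2 + l2\<^sup>2 - l1 * l2) * v$1 = 0"
    by algebra
  then show "l1\<^sup>2 + l2\<^sup>2 - l1 * l2 = 0"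
    using v1 by simp
next
  assume eq: "l1\<^sup>2 + l2\<^sup>2 - l1 * l2 = 0"
  \<comment> \<open>This spans the eigenspace of \<open>\<rho> x\<close> for \<open>l2\<close>; the
    equation \<open>eq\<close> is what makes it an eigenvector of \<open>\<rho> y\<close>
    too.\<close>
  let ?v = "vector [l1, l2 - l1] :: 'a ^ 2"
  have "\<rho> x *v ?v = l2 *s ?v"
    by (simp add: \<rho> vec2_eq_iff matrix_vector_mult_2 algebra_simps)
  moreover have "- l2 * l1 + l1 * (l2 - l1) = l2 * (l2 - l1)"
    using eq by algebra
  then have "\<rho> y *v ?v = l2 *s ?v"
    by (simp add: \<rho> vec2_eq_iff matrix_vector_mult_2)
  moreover have "?v \<noteq> 0"
    using assms(1) by (simp add: vec2_eq_iff)
  ultimately show "\<exists>v. common_eigenvector \<rho> {x, y} v"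
    unfolding common_eigenvector_def by blast
qed

lemma SB3_irreducible_normal_basis:
  fixes \<rho> :: "sb3_gen word set \<Rightarrow> complex ^ 2 ^ 2"
  assumes rep: "matrix_rep SB3 \<rho>" and irr: "irreducible_rep SB3 \<rho>"
  obtains P :: "complex ^ 2 ^ 2" and l1 l2 where "invertible P" "l1 \<noteq> 0" "l2 \<noteq> 0"
    "matrix_inv P ** \<rho> (sb3 Sigma1) ** P = vector [vector [l1, l1], vector [0, l2]]"
    "matrix_inv P ** \<rho> (sb3 Sigma2) ** P = vector [vector [l2, 0], vector [- l2, l1]]"
proof -
  let ?S1 = "\<rho> (sb3 Sigma1)" and ?S2 = "\<rho> (sb3 Sigma2)"
  have det_S: "det ?S1 \<noteq> 0" "det ?S2 \<noteq> 0"
    using matrix_rep_invertible[OF rep] by (simp_all flip: invertible_det_nz)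
  obtain l1 v where v: "v \<noteq> 0" "?S1 *v v = l1 *s v"
    by (rule eigenvector_exists_2)
  have l1: "l1 \<noteq> 0"
  proof
    assume "l1 = 0"
    with v have "?S1 *v v = 0" by simp
    then show False
      using v(1) det_S(1) by (metis invertible_det_nz matrix_inv_inverse(2) matrix_vector_mul_assoc
          matrix_vector_mul_lid matrix_vector_mult_0_right)
  qed
  \<comment> \<open>Defining the other eigenvalue through the determinant also covers a repeated
    eigenvalue.\<close>
  define l2 where "l2 = det ?S1 / l1"
  have l2: "l2 \<noteq> 0"
    using l1 det_S by (simp add: l2_def)
  \<comment> \<open>Solved from the wanted first column of the second generator, that is, from
    \<open>?S2 *v v = l2 *s v - l2 *s w\<close>.\<close>
  define w where "w = v - inverse l2 *s (?S2 *v v)"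
  have S2v: "?S2 *v v = l2 *s v - l2 *s w"
    using l2 by (simp add: w_def vec.scale_right_diff_distrib vector_smult_assoc)
  have "wedge v w \<noteq> 0"
  proof
    assume "wedge v w = 0"
    then obtain c where "w = c *s v"
      using wedge_eq_0_imp_multiple v(1) by blast
    then have "?S2 *v v = (l2 - l2 * c) *s v"
      by (simp add: S2v vec.scale_left_diff_distrib vector_smult_assoc)
    then have "common_eigenvector \<rho> {sb3 Sigma1, sb3 Sigma2} v"
      using v unfolding common_eigenvector_def by blast
    then show False
      using SB3_irreducible_no_common_eigenvector[OF rep irr] by blast
  qed
  define P where "P = (vector [vector [v$1, w$1], vector [v$2, w$2]] :: complex ^ 2 ^ 2)"
  have invP: "invertible P"
    using \<open>wedge v w \<noteq> 0\<close>
    by (simp add: invertible_det_nz det_2 P_def wedge_def mult.commute)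
  note P = matrix_inv_inverse[OF invP]
  define \<rho>0 where "\<rho>0 = (\<lambda>g. matrix_inv P ** \<rho> g ** P)"
  have rep0: "matrix_rep SB3 \<rho>0"
    unfolding \<rho>0_def by (rule matrix_rep_conjugate[OF rep invP])
  have Pe: "P *v vector [a, b] = a *s v + b *s w" for a b
    by (simp add: vec2_eq_iff matrix_vector_mult_2 P_def mult.commute)
  have Pinv: "matrix_inv P *v (a *s v + b *s w) = vector [a, b]" for a b
    unfolding Pe[symmetric] by (simp add: matrix_vector_mul_assoc P)
  have \<rho>0e: "\<rho>0 g *v vector [1, 0] = matrix_inv P *v (\<rho> g *v v)" for g
    using Pe[of 1 0] by (simp add: \<rho>0_def matrix_vector_mul_assoc[symmetric])
  have "\<rho>0 (sb3 Sigma1) *v vector [1, 0] = vector [l1, 0]"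
    using Pinv[of l1 0] by (simp add: \<rho>0e v)
  then have S1: "\<rho>0 (sb3 Sigma1) $1$1 = l1" "\<rho>0 (sb3 Sigma1) $2$1 = 0"
    by (simp_all add: vec2_eq_iff matrix_vector_mult_2)
  have "\<rho>0 (sb3 Sigma2) *v vector [1, 0] = vector [l2, - l2]"
    using Pinv[of l2 "- l2"] by (simp add: \<rho>0e S2v)
  then have S2: "\<rho>0 (sb3 Sigma2) $1$1 = l2" "\<rho>0 (sb3 Sigma2) $2$1 = - l2"
    by (simp_all add: vec2_eq_iff matrix_vector_mult_2)
  have "det (matrix_inv P) * det P = 1"
    by (metis P(2) det_I det_mul)
  \<comment> \<open>Determinants are invariant under conjugation, so the determinant hypotheses of
    \<open>normal_form_braid\<close> can be checked on \<open>\<rho>\<close>.\<close>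
  then have det0: "det (\<rho>0 g) = det (\<rho> g)" for g
    by (simp add: \<rho>0_def det_mul mult.commute mult.left_commute)
  have "det (\<rho>0 (sb3 Sigma1)) = l1 * l2"
    using l1 by (simp add: det0 l2_def)
  note nf = normal_form_braid[OF SB3_relations(1)[OF rep0] S1 S2 this det_S[folded det0]]
  show ?thesis
    by (rule that[OF invP l1 l2 nf[unfolded \<rho>0_def]])
qed

section \<open>Classification of the irreducible representations\<close>

theorem corollary19:
  fixes \<rho>' :: "sb3_gen word set \<Rightarrow> complex ^ 2 ^ 2"
  assumes "matrix_rep SB3 \<rho>'"
  shows "irreducible_rep SB3 \<rho>' \<longleftrightarrow>
    (\<exists>(\<rho> :: sb3_gen word set \<Rightarrow> complex ^ 2 ^ 2) a1 b1 d1 a2 c2 d2 l1 l2.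
      matrix_rep SB3 \<rho> \<and> equivalent_rep SB3 \<rho> \<rho>' \<and>
      \<rho> (sb3 Sigma1) = vector [vector [l1, l1], vector [0, l2]] \<and>
      \<rho> (sb3 Sigma2) = vector [vector [l2, 0], vector [- l2, l1]] \<and>
      \<rho> (sb3 Tau1) = vector [vector [a1, b1], vector [0, d1]] \<and>
      \<rho> (sb3 Tau2) = vector [vector [a2, 0], vector [c2, d2]] \<and>
      a1 \<noteq> 0 \<and> d1 \<noteq> 0 \<and> a2 \<noteq> 0 \<and> d2 \<noteq> 0 \<and> l1 \<noteq> 0 \<and> l2 \<noteq> 0 \<and>
      l1\<^sup>2 + l2\<^sup>2 - l1 * l2 \<noteq> 0 \<and>
      d1 = a2 \<and> a2 = a1 - b1 * (l1 - l2) / l1 \<and>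
      c2 = - (b1 * l2 / l1) \<and> d2 = a1)"
    (is "_ \<longleftrightarrow> ?normal_form")
proof
  assume irr: "irreducible_rep SB3 \<rho>'"
  obtain P :: "complex ^ 2 ^ 2" and l1 l2 where P: "invertible P" and nz: "l1 \<noteq> 0" "l2 \<noteq> 0"
    and S: "matrix_inv P ** \<rho>' (sb3 Sigma1) ** P = vector [vector [l1, l1], vector [0, l2]]"
      "matrix_inv P ** \<rho>' (sb3 Sigma2) ** P = vector [vector [l2, 0], vector [- l2, l1]]"
    by (rule SB3_irreducible_normal_basis[OF assms irr])
  define \<rho> where "\<rho> = (\<lambda>g. matrix_inv P ** \<rho>' g ** P)"
  have rep: "matrix_rep SB3 \<rho>" and equiv: "equivalent_rep SB3 \<rho> \<rho>'"
    unfolding \<rho>_def by (rule matrix_rep_conjugate[OF assms P], rule equivalent_rep_conjugate[OF P])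
  note S = S[folded fun_cong[OF \<rho>_def]]
  note relations = SB3_relations[OF rep]
  obtain a b d where T: "\<rho> (sb3 Tau1) = vector [vector [a, b], vector [0, d]]"
    "\<rho> (sb3 Tau2) = vector [vector [d, 0], vector [- (b * l2 / l1), a]]"
    and d: "d = a - b * (l1 - l2) / l1"
    by (rule normal_form_singular[OF S nz relations(2-4)])
  have "det (\<rho> (sb3 Tau1)) \<noteq> 0"
    using matrix_rep_invertible[OF rep] by (simp flip: invertible_det_nz)
  then have "a \<noteq> 0" "d \<noteq> 0"
    by (auto simp: T det_2)
  \<comment> \<open>A common eigenvector in the new basis would be carried by \<open>P\<close> to
    one for \<open>\<rho>'\<close>; its absence gives the quadratic condition.\<close>
  moreover have "\<not> common_eigenvector \<rho> {sb3 Sigma1, sb3 Sigma2} v" for v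
  proof
    assume v: "common_eigenvector \<rho> {sb3 Sigma1, sb3 Sigma2} v"
    have "P ** \<rho> g = \<rho>' g ** P" for g
      by (simp add: \<rho>_def matrix_mul_assoc matrix_inv_inverse[OF P])
    then show False
      using common_eigenvector_intertwine[OF v P] SB3_irreducible_no_common_eigenvector[OF assms irr]
      by blast
  qed
  then have "l1\<^sup>2 + l2\<^sup>2 - l1 * l2 \<noteq> 0"
    using normal_form_common_eigenvector[OF nz, of \<rho>, OF S] by blast
  ultimately show ?normal_form
    using rep equiv S T nz d by blast
next
  assume ?normal_form
  then obtain \<rho> :: "sb3_gen word set \<Rightarrow> complex ^ 2 ^ 2" and l1 l2
    where equiv: "equivalent_rep SB3 \<rho> \<rho>'"
      and S: "\<rho> (sb3 Sigma1) = vector [vector [l1, l1], vector [0, l2]]"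
        "\<rho> (sb3 Sigma2) = vector [vector [l2, 0], vector [- l2, l1]]"
      and nz: "l1 \<noteq> 0" "l2 \<noteq> 0" "l1\<^sup>2 + l2\<^sup>2 - l1 * l2 \<noteq> 0"
    by blast
  obtain P where P: "invertible P" "\<And>g. g \<in> carrier SB3 \<Longrightarrow> \<rho>' g = matrix_inv P ** \<rho> g ** P"
    using equiv unfolding equivalent_rep_def by blast
  have comm: "P ** \<rho>' g = \<rho> g ** P" if "g \<in> carrier SB3" for g
    by (simp add: P(2)[OF that] matrix_mul_assoc matrix_inv_inverse[OF P(1)])
  \<comment> \<open>Transported by \<open>P\<close> and restricted to the two braid generators, such
    a vector would violate the quadratic condition.\<close>
  have "\<not> common_eigenvector \<rho>' (carrier SB3) v" for v
  proof
    assume "common_eigenvector \<rho>' (carrier SB3) v"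
    then have "common_eigenvector \<rho> (carrier SB3) (P *v v)"
      using common_eigenvector_intertwine P(1) comm by blast
    then have "common_eigenvector \<rho> {sb3 Sigma1, sb3 Sigma2} (P *v v)"
      by (simp add: common_eigenvector_def)
    then show False
      using normal_form_common_eigenvector[OF nz(1,2), of \<rho>, OF S] nz(3) by blast
  qed
  then show "irreducible_rep SB3 \<rho>'"
    using irreducible_rep_iff_no_common_eigenvector by blast
qed

end
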